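(* $[\mathbf{Txt}\mathbf{It}\mathbf{Ex}_C]_{\mathbf{REC}} \setminus [\mathbf{Txt}\mathbf{G}\mathbf{CInd}\mathbf{Bc}_C]_{\mathbf{REC}} \neq \emptyset$.
   Context: Fix an acceptable numbering $(\varphi_e)_{e\in\mathbb{N}}$ of all partial computable functions. A number $e$ is a $C$-index if $\varphi_e$ is total with values in $\{0,1\}$; then $C_e=\{x:\varphi_e(x)=1\}$. $\mathbf{REC}$ is the collection of recursive subsets of $\mathbb{N}$; $\mathcal{P}$ denotes the partial computable functions. Fix a pause symbol $\#$. A text is a total function $T:\mathbb{N}\to\mathbb{N}\cup\{\#\}$, $\mathrm{content}(T)=\mathrm{range}(T)\setminus\{\#\}$, $T$ is a text for $L$ if $\mathrm{content}(T)=L$, $T[n]=(T(0),\dots,T(n-1))$. A learner is some $h\in\mathcal{P}$. Hypothesis sequences: full-information $\mathbf{G}(h,T)(i)=h(T[i])$; iterative $\mathbf{It}(h,T)(0)=h(\varepsilon)$ and $\mathbf{It}(h,T)(i)=h(\mathbf{It}(h,T)(i-1),T(i-1))$ for $i>0$. Restrictions on hypothesis sequence $p$ and text $T$: $\mathbf{Ex}_C$: there is $n_0$ with $p(n)=p(n_0)$ for all $n\ge n_0$ and $p(n_0)$ a $C$-index with $C_{p(n_0)}=\mathrm{content}(T)$; $\mathbf{Bc}_C$: there is $n_0$ such that for all $n\ge n_0$, $p(n)$ is a $C$-index with $C_{p(n)}=\mathrm{content}(T)$; $\mathbf{CInd}$: for all $i$, $p(i)$ is a $C$-index. Juxtaposition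 means conjunction. $h$ $\mathbf{Txt}\beta\delta$-learns $L$ iff $\delta(\beta(h,T),T)$ holds for every text $T$ for $L$; $[\mathbf{Txt}\beta\delta]_{\mathbf{REC}}$ is the set of all classes $\mathcal{L}\subseteq\mathbf{REC}$ for which some $h\in\mathcal{P}$ learns every $L\in\mathcal{L}$. *)

theory Defs
  imports "HOL-Library.Nat_Bijection"
begin

text \<open>
  Partial recursive functions are given by Kleene's schemes, with \<open>None\<close> for divergence. Arities are
  implicit: an operation applied to a list of unsuitable length diverges, so restricting
  \<open>rec_eval r\<close> to lists of one fixed length always gives a partial recursive function of that
  arity, and all of them arise in this way.
\<close>

datatype recf =
    Zero
  | Succ
  | Proj nat
  | Comp recf "recf list"
  | PrimRec recf recf
  | Mu recf

fun rec_eval :: "recf \<Rightarrow> nat list \<Rightarrow> nat option" where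
  "rec_eval Zero xs = Some 0"
| "rec_eval Succ xs = (case xs of [x] \<Rightarrow> Some (Suc x) | _ \<Rightarrow> None)"
| "rec_eval (Proj i) xs = (if i < length xs then Some (xs ! i) else None)"
| "rec_eval (Comp f gs) xs =
     (case those (map (\<lambda>g. rec_eval g xs) gs) of None \<Rightarrow> None | Some ys \<Rightarrow> rec_eval f ys)"
| "rec_eval (PrimRec f g) xs =
     (case xs of
        [] \<Rightarrow> None
      | n # ys \<Rightarrow>
          rec_nat (rec_eval f ys)
            (\<lambda>m r. case r of None \<Rightarrow> None | Some y \<Rightarrow> rec_eval g (m # y # ys)) n)"
| "rec_eval (Mu f) xs =
     (if \<exists>n. rec_eval f (n # xs) = Some 0 \<and> (\<forall>m<n. rec_eval f (m # xs) \<noteq> None)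
      then Some (LEAST n. rec_eval f (n # xs) = Some 0)
      else None)"

definition partial_computable :: "(nat \<Rightarrow> nat option) \<Rightarrow> bool" where
  "partial_computable f \<longleftrightarrow> (\<exists>r. \<forall>x. rec_eval r [x] = f x)"

definition partial_computable2 :: "(nat \<Rightarrow> nat \<Rightarrow> nat option) \<Rightarrow> bool" where
  "partial_computable2 f \<longleftrightarrow> (\<exists>r. \<forall>x y. rec_eval r [x, y] = f x y)"

definition computable :: "(nat \<Rightarrow> nat) \<Rightarrow> bool" where
  "computable f \<longleftrightarrow> partial_computable (\<lambda>x. Some (f x))"

definition REC :: "nat set set" where
  "REC = {A. computable (\<lambda>x. if x \<in> A then 1 else 0)}"

text \<open>
  Acceptability in the sense of Rogers: the universal function is partial computable, and every
  partial computable \<open>\<psi>\<close> of two arguments translates effectively into \<open>\<phi>\<close>. Taking \<open>\<psi> e\<close>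
  independent of \<open>e\<close>, the second condition shows that \<open>\<phi>\<close> enumerates all partial computable
  functions.
\<close>

definition acceptable_numbering :: "(nat \<Rightarrow> nat \<Rightarrow> nat option) \<Rightarrow> bool" where
  "acceptable_numbering \<phi> \<longleftrightarrow>
     partial_computable2 \<phi> \<and>
     (\<forall>\<psi>. partial_computable2 \<psi> \<longrightarrow> (\<exists>f. computable f \<and> (\<forall>e. \<phi> (f e) = \<psi> e)))"

definition C_index :: "(nat \<Rightarrow> nat \<Rightarrow> nat option) \<Rightarrow> nat \<Rightarrow> bool" where
  "C_index \<phi> e \<longleftrightarrow> (\<forall>x. \<phi> e x = Some 0 \<or> \<phi> e x = Some 1)"

definition C_set :: "(nat \<Rightarrow> nat \<Rightarrow> nat option) \<Rightarrow> nat \<Rightarrow> nat set" where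
  "C_set \<phi> e = {x. \<phi> e x = Some 1}"

text \<open>In a text, \<open>None\<close> is the pause symbol.\<close>

type_synonym text_seq = "nat \<Rightarrow> nat option"

definition content :: "text_seq \<Rightarrow> nat set" where
  "content T = {x. Some x \<in> range T}"

definition text_for :: "text_seq \<Rightarrow> nat set \<Rightarrow> bool" where
  "text_for T L \<longleftrightarrow> content T = L"

definition initial_segment :: "text_seq \<Rightarrow> nat \<Rightarrow> nat option list" where
  "initial_segment T n = map T [0..<n]"

text \<open>
  Learners are partial computable functions on natural numbers; finite sequences are passed to
  them through \<open>list_encode\<close>, the pause symbol being coded by \<open>0\<close> and a number \<open>x\<close> by
  \<open>Suc x\<close>. A hypothesis sequence is partial, since a learner may diverge.
\<close>

type_synonym learner = "nat \<Rightarrow> nat option"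
type_synonym hyp_seq = "nat \<Rightarrow> nat option"

fun datum_encode :: "nat option \<Rightarrow> nat" where
  "datum_encode None = 0"
| "datum_encode (Some x) = Suc x"

definition G :: "learner \<Rightarrow> text_seq \<Rightarrow> hyp_seq" where
  "G h T i = h (list_encode (map datum_encode (initial_segment T i)))"

primrec It :: "learner \<Rightarrow> text_seq \<Rightarrow> hyp_seq" where
  "It h T 0 = h (list_encode [])"
| "It h T (Suc i) =
     (case It h T i of
        None \<Rightarrow> None
      | Some e \<Rightarrow> h (list_encode [e, datum_encode (T i)]))"

definition Ex_C :: "(nat \<Rightarrow> nat \<Rightarrow> nat option) \<Rightarrow> hyp_seq \<Rightarrow> text_seq \<Rightarrow> bool" where
  "Ex_C \<phi> p T \<longleftrightarrow>
     (\<exists>n0. (\<forall>n\<ge>n0. p n = p n0) \<and>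
           (\<exists>e. p n0 = Some e \<and> C_index \<phi> e \<and> C_set \<phi> e = content T))"

definition Bc_C :: "(nat \<Rightarrow> nat \<Rightarrow> nat option) \<Rightarrow> hyp_seq \<Rightarrow> text_seq \<Rightarrow> bool" where
  "Bc_C \<phi> p T \<longleftrightarrow>
     (\<exists>n0. \<forall>n\<ge>n0. \<exists>e. p n = Some e \<and> C_index \<phi> e \<and> C_set \<phi> e = content T)"

definition CInd :: "(nat \<Rightarrow> nat \<Rightarrow> nat option) \<Rightarrow> hyp_seq \<Rightarrow> text_seq \<Rightarrow> bool" where
  "CInd \<phi> p T \<longleftrightarrow> (\<forall>i. \<exists>e. p i = Some e \<and> C_index \<phi> e)"

definition Txt_learns ::
  "(learner \<Rightarrow> text_seq \<Rightarrow> hyp_seq) \<Rightarrow> (hyp_seq \<Rightarrow> text_seq \<Rightarrow> bool) \<Rightarrow> learner \<Rightarrow> nat set \<Rightarrow> bool" where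
  "Txt_learns \<beta> \<delta> h L \<longleftrightarrow> (\<forall>T. text_for T L \<longrightarrow> \<delta> (\<beta> h T) T)"

definition Txt_REC ::
  "(learner \<Rightarrow> text_seq \<Rightarrow> hyp_seq) \<Rightarrow> (hyp_seq \<Rightarrow> text_seq \<Rightarrow> bool) \<Rightarrow> nat set set set" where
  "Txt_REC \<beta> \<delta> =
     {\<L>. \<L> \<subseteq> REC \<and> (\<exists>h. partial_computable h \<and> (\<forall>L\<in>\<L>. Txt_learns \<beta> \<delta> h L))}"

end

theory Submission
  imports Defs
begin

text \<open>
  The separating class consists of the languages whose largest even element \<open>2 * e\<close> names a
  \<open>C\<close>-index \<open>e\<close> of the language itself; an iterative learner simply keeps the largest such \<open>e\<close>
  seen so far. By the recursion theorem every finite set extends to a language of the class, so a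
  full-information learner of the class with \<open>CInd\<close> outputs \<open>C\<close>-indices on all finite sequences,
  and its hypotheses form a uniformly decidable family. Diagonalising against this family on the
  odd numbers and applying the recursion theorem again yields a language of the class which the
  learner never conjectures.
\<close>

section \<open>Closure properties of total recursive functions and decidable predicates\<close>

definition total_recursive :: "nat \<Rightarrow> (nat list \<Rightarrow> nat) \<Rightarrow> bool" where
  "total_recursive k f \<longleftrightarrow> (\<exists>r. \<forall>xs. length xs = k \<longrightarrow> rec_eval r xs = Some (f xs))"

abbreviation computable2 :: "(nat \<Rightarrow> nat \<Rightarrow> nat) \<Rightarrow> bool" where
  "computable2 f \<equiv> partial_computable2 (\<lambda>x y. Some (f x y))"

abbreviation decidable :: "nat \<Rightarrow> (nat list \<Rightarrow> bool) \<Rightarrow> bool" where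
  "decidable k P \<equiv> total_recursive k (\<lambda>xs. of_bool (P xs))"

named_theorems recursive_intros

lemma computableI:
  assumes "total_recursive 1 (\<lambda>xs. f (xs ! 0))"
  shows "computable f"
proof -
  obtain r where r: "\<And>xs. length xs = 1 \<Longrightarrow> rec_eval r xs = Some (f (xs ! 0))"
    using assms unfolding total_recursive_def by blast
  have "rec_eval r [x] = Some (f x)" for x
    using r[of "[x]"] by simp
  then show ?thesis
    unfolding computable_def partial_computable_def by blast
qed

lemma computable2I:
  assumes "total_recursive 2 (\<lambda>xs. f (xs ! 0) (xs ! 1))"
  shows "computable2 f"
proof -
  obtain r where r: "\<And>xs. length xs = 2 \<Longrightarrow> rec_eval r xs = Some (f (xs ! 0) (xs ! 1))"
    using assms unfolding total_recursive_def by blast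
  have "rec_eval r [x, y] = Some (f x y)" for x y
    using r[of "[x, y]"] by simp
  then show ?thesis
    unfolding partial_computable2_def by blast
qed

lemma total_recursive_nth [recursive_intros]: "i < k \<Longrightarrow> total_recursive k (\<lambda>xs. xs ! i)"
  unfolding total_recursive_def by (rule exI[of _ "Proj i"]) simp

lemma total_recursive_comp:
  assumes "computable f" "total_recursive k a"
  shows "total_recursive k (\<lambda>xs. f (a xs))"
proof -
  obtain r s where "\<And>x. rec_eval r [x] = Some (f x)"
    and "\<And>xs. length xs = k \<Longrightarrow> rec_eval s xs = Some (a xs)"
    using assms unfolding computable_def partial_computable_def total_recursive_def by blast
  then show ?thesis
    unfolding total_recursive_def by (intro exI[of _ "Comp r [s]"]) simp
qed

lemma total_recursive_comp2:
  assumes "computable2 f" "total_recursive k a" "total_recursive k b"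
  shows "total_recursive k (\<lambda>xs. f (a xs) (b xs))"
proof -
  obtain r s t where "\<And>x y. rec_eval r [x, y] = Some (f x y)"
    and "\<And>xs. length xs = k \<Longrightarrow> rec_eval s xs = Some (a xs)"
    and "\<And>xs. length xs = k \<Longrightarrow> rec_eval t xs = Some (b xs)"
    using assms unfolding partial_computable2_def total_recursive_def by blast
  then show ?thesis
    unfolding total_recursive_def by (intro exI[of _ "Comp r [s, t]"]) simp
qed

lemma computable_Suc: "computable Suc"
  unfolding computable_def partial_computable_def by (rule exI[of _ Succ]) simp

lemmas total_recursive_Suc [recursive_intros] = total_recursive_comp[OF computable_Suc]

lemma total_recursive_const [recursive_intros]: "total_recursive k (\<lambda>xs. c)"
proof (induction c)
  case 0
  show ?case
    unfolding total_recursive_def by (rule exI[of _ Zero]) simp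
next
  case (Suc c)
  then show ?case by (rule total_recursive_Suc)
qed

lemma computable2_primrec:
  assumes "total_recursive 1 (\<lambda>xs. f (xs ! 0))"
    and "total_recursive 3 (\<lambda>xs. g (xs ! 0) (xs ! 1) (xs ! 2))"
    and "\<And>y. h 0 y = f y" "\<And>n y. h (Suc n) y = g n (h n y) y"
  shows "computable2 h"
proof -
  obtain r s where r: "\<And>xs. length xs = 1 \<Longrightarrow> rec_eval r xs = Some (f (xs ! 0))"
    and s: "\<And>xs. length xs = 3 \<Longrightarrow> rec_eval s xs = Some (g (xs ! 0) (xs ! 1) (xs ! 2))"
    using assms(1,2) unfolding total_recursive_def by blast
  have "rec_eval (PrimRec r s) [n, y] = Some (h n y)" for n y
    by (induction n) (simp_all add: r s assms(3,4))
  then show ?thesis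
    unfolding partial_computable2_def by blast
qed

lemma computable_primrec:
  assumes "total_recursive 3 (\<lambda>xs. g (xs ! 0) (xs ! 1))"
    and "\<And>n. h (Suc n) = g n (h n)"
  shows "computable h"
proof -
  \<comment> \<open>Unary recursion is binary recursion with a dummy parameter; hence the arity 3 of
    the step function.\<close>
  have "computable2 (\<lambda>n y. h n)"
    by (rule computable2_primrec[where f = "\<lambda>y. h 0" and g = "\<lambda>m r y. g m r"])
      (rule total_recursive_const assms refl)+
  then have "total_recursive 1 (\<lambda>xs. h (xs ! 0))"
    by (rule total_recursive_comp2) (rule total_recursive_nth zero_less_one)+
  then show ?thesis by (rule computableI)
qed

lemma total_recursive_add [recursive_intros]:
  assumes "total_recursive k a" "total_recursive k b"
  shows "total_recursive k (\<lambda>xs. a xs + b xs)"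
proof (rule total_recursive_comp2[OF _ assms])
  show "computable2 (+)"
    by (rule computable2_primrec[where f = "\<lambda>y. y" and g = "\<lambda>m r y. Suc r"])
      (auto intro!: recursive_intros)
qed

lemma total_recursive_mult [recursive_intros]:
  assumes "total_recursive k a" "total_recursive k b"
  shows "total_recursive k (\<lambda>xs. a xs * b xs)"
proof (rule total_recursive_comp2[OF _ assms])
  show "computable2 (*)"
    by (rule computable2_primrec[where f = "\<lambda>y. 0" and g = "\<lambda>m r y. r + y"])
      (auto intro!: recursive_intros)
qed

lemma computable_pred: "computable (\<lambda>n. n - 1)"
  by (rule computable_primrec[where g = "\<lambda>m r. m"]) (auto intro!: recursive_intros)

lemma total_recursive_diff [recursive_intros]:
  assumes "total_recursive k a" "total_recursive k b"
  shows "total_recursive k (\<lambda>xs. a xs - b xs)"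
\<comment> \<open>Truncated subtraction recurses on the subtrahend by iterating the predecessor, so
  the arguments are swapped.\<close>
proof (rule total_recursive_comp2[OF _ assms(2,1)])
  show "computable2 (\<lambda>n y. y - n)"
    by (rule computable2_primrec[where f = "\<lambda>y. y" and g = "\<lambda>m r y. r - 1"])
      (rule total_recursive_comp[OF computable_pred] recursive_intros | simp)+
qed

lemma decidable_not [recursive_intros]:
  assumes "decidable k P"
  shows "decidable k (\<lambda>xs. \<not> P xs)"
proof -
  have "total_recursive k (\<lambda>xs. 1 - of_bool (P xs))"
    by (intro recursive_intros assms)
  moreover have "1 - of_bool p = (of_bool (\<not> p) :: nat)" for p
    by simp
  ultimately show ?thesis by (simp only:)
qed

lemma decidable_conj [recursive_intros]:
  assumes "decidable k P" "decidable k Q"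
  shows "decidable k (\<lambda>xs. P xs \<and> Q xs)"
  using total_recursive_mult[OF assms] by (simp add: of_bool_conj)

lemma decidable_disj [recursive_intros]:
  assumes "decidable k P" "decidable k Q"
  shows "decidable k (\<lambda>xs. P xs \<or> Q xs)"
proof -
  have "decidable k (\<lambda>xs. \<not> (\<not> P xs \<and> \<not> Q xs))"
    by (intro recursive_intros assms)
  then show ?thesis by simp
qed

lemma decidable_le [recursive_intros]:
  assumes "total_recursive k a" "total_recursive k b"
  shows "decidable k (\<lambda>xs. a xs \<le> b xs)"
proof -
  have "total_recursive k (\<lambda>xs. 1 - (a xs - b xs))"
    by (intro recursive_intros assms)
  moreover have "1 - (x - y) = of_bool (x \<le> y)" for x y :: nat
    by auto
  ultimately show ?thesis by (simp only:)
qed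

lemma decidable_eq [recursive_intros]:
  assumes "total_recursive k a" "total_recursive k b"
  shows "decidable k (\<lambda>xs. a xs = b xs)"
proof -
  have "decidable k (\<lambda>xs. a xs \<le> b xs \<and> b xs \<le> a xs)"
    by (intro recursive_intros assms)
  then show ?thesis by (simp add: eq_iff)
qed

lemma decidable_finite [recursive_intros]:
  assumes "finite F" "total_recursive k a"
  shows "decidable k (\<lambda>xs. a xs \<in> F)"
  using assms(1)
proof (induction F rule: finite_induct)
  case empty
  show ?case by (simp add: total_recursive_const)
next
  case (insert c F)
  then have "decidable k (\<lambda>xs. a xs = c \<or> a xs \<in> F)"
    by (intro recursive_intros assms(2))
  then show ?case by simp
qed

lemma total_recursive_if [recursive_intros]:
  assumes "decidable k P" "total_recursive k a" "total_recursive k b"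
  shows "total_recursive k (\<lambda>xs. if P xs then a xs else b xs)"
proof -
  have "total_recursive k (\<lambda>xs. of_bool (P xs) * a xs + of_bool (\<not> P xs) * b xs)"
    by (intro recursive_intros assms)
  moreover have "of_bool p * x + of_bool (\<not> p) * y = (if p then x else y)" for p and x y :: nat
    by simp
  ultimately show ?thesis by (simp only:)
qed

lemma computable_mod2: "computable (\<lambda>n. n mod 2)"
proof (rule computable_primrec[where g = "\<lambda>m r. 1 - r"])
  show "Suc n mod 2 = 1 - n mod 2" for n by presburger
qed (auto intro!: recursive_intros)

lemmas total_recursive_mod2 [recursive_intros] = total_recursive_comp[OF computable_mod2]

lemma computable_div2: "computable (\<lambda>n. n div 2)"
proof (rule computable_primrec[where g = "\<lambda>m r. r + m mod 2"])
  show "Suc n div 2 = n div 2 + n mod 2" for n by presburger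
qed (auto intro!: recursive_intros)

lemmas total_recursive_div2 [recursive_intros] = total_recursive_comp[OF computable_div2]

lemma decidable_even [recursive_intros]:
  assumes "total_recursive k a"
  shows "decidable k (\<lambda>xs. even (a xs))"
proof -
  have "decidable k (\<lambda>xs. a xs mod 2 = 0)"
    by (intro recursive_intros assms)
  then show ?thesis by (simp add: even_iff_mod_2_eq_zero)
qed

lemma computable_triangle: "computable triangle"
  by (rule computable_primrec[where g = "\<lambda>m r. r + Suc m"]) (auto intro!: recursive_intros)

lemmas total_recursive_triangle [recursive_intros] = total_recursive_comp[OF computable_triangle]

text \<open>\<open>Mu\<close> finds the least zero, so it is applied to the indicator of the negated
  predicate, with the search variable at the head of the list. Decidability makes every earlier
  value defined, and the second assumption ends the search.\<close>

lemma total_recursive_Least: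
  assumes "decidable (Suc k) (\<lambda>xs. P (hd xs) (tl xs))"
    and "\<And>xs. length xs = k \<Longrightarrow> \<exists>n. P n xs"
  shows "total_recursive k (\<lambda>xs. LEAST n. P n xs)"
proof -
  obtain r where r: "\<And>xs. length xs = Suc k \<Longrightarrow>
      rec_eval r xs = Some (of_bool (\<not> P (hd xs) (tl xs)))"
    using decidable_not[OF assms(1)] unfolding total_recursive_def by blast
  then have "rec_eval (Mu r) xs = Some (LEAST n. P n xs)" if "length xs = k" for xs
    using assms(2)[OF that] that by simp
  then show ?thesis
    unfolding total_recursive_def by blast
qed

section \<open>Computability of the inverse of the pairing function\<close>

text \<open>The sum of the two components of \<open>prod_decode z\<close>.\<close>

definition diagonal :: "nat \<Rightarrow> nat" where
  "diagonal z = (LEAST n. z < triangle (Suc n))"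

lemma triangle_mono: "m \<le> n \<Longrightarrow> triangle m \<le> triangle n"
  unfolding triangle_def by (intro div_le_mono mult_le_mono) auto

text \<open>Since \<open>prod_encode (m, n) = triangle (m + n) + m\<close> and
  \<open>m < Suc (m + n)\<close>, the code lies in the half-open interval from
  \<open>triangle (m + n)\<close> to \<open>triangle (Suc (m + n))\<close>.\<close>

lemma diagonal_prod_encode: "diagonal (prod_encode (m, n)) = m + n"
  unfolding diagonal_def
proof (rule Least_equality)
  show "prod_encode (m, n) < triangle (Suc (m + n))"
    by (simp add: prod_encode_def)
  show "m + n \<le> k" if "prod_encode (m, n) < triangle (Suc k)" for k
  proof (rule ccontr)
    assume "\<not> m + n \<le> k"
    then have "triangle (Suc k) \<le> triangle (m + n)"
      by (intro triangle_mono) simp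
    with that show False by (simp add: prod_encode_def)
  qed
qed

lemma computable_diagonal: "computable diagonal"
proof (rule computableI)
  have "decidable 2 (\<lambda>xs. \<not> triangle (Suc (xs ! 0)) \<le> xs ! 1)"
    by (intro recursive_intros) auto
  then obtain r where r: "\<And>xs. length xs = 2 \<Longrightarrow>
      rec_eval r xs = Some (of_bool (\<not> triangle (Suc (xs ! 0)) \<le> xs ! 1))"
    unfolding total_recursive_def by blast
  \<comment> \<open>The closure rules speak of \<open>xs ! 0\<close> and \<open>xs ! 1\<close>, the
    minimisation rule of \<open>hd\<close> and \<open>tl\<close>; on lists of length 2 these
    agree.\<close>
  have "decidable (Suc 1) (\<lambda>xs. tl xs ! 0 < triangle (Suc (hd xs)))"
    unfolding total_recursive_def
  proof (intro exI[of _ r] allI impI)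
    fix xs :: "nat list" assume "length xs = Suc 1"
    then show "rec_eval r xs = Some (of_bool (tl xs ! 0 < triangle (Suc (hd xs))))"
      using r[of xs] by (cases xs) (auto simp: not_le)
  qed
  then show "total_recursive 1 (\<lambda>xs. diagonal (xs ! 0))"
    unfolding diagonal_def
  proof (rule total_recursive_Least)
    show "\<exists>n. xs ! 0 < triangle (Suc n)" for xs :: "nat list"
      by (rule exI[of _ "xs ! 0"]) simp
  qed
qed

lemmas total_recursive_diagonal [recursive_intros] = total_recursive_comp[OF computable_diagonal]

text \<open>This and the next formula reduce both projections to computable operations. As
  \<open>list_encode\<close> is built from \<open>prod_encode\<close>, a learner can thereby read
  its input.\<close>

lemma fst_prod_decode: "fst (prod_decode z) = z - triangle (diagonal z)"
proof -
  obtain m n where "z = prod_encode (m, n)"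
    by (metis prod_decode_inverse surj_pair)
  then show ?thesis
    by (simp add: diagonal_prod_encode) (simp add: prod_encode_def)
qed

lemma snd_prod_decode: "snd (prod_decode z) = diagonal z - fst (prod_decode z)"
proof -
  obtain m n where "z = prod_encode (m, n)"
    by (metis prod_decode_inverse surj_pair)
  then show ?thesis
    by (simp add: diagonal_prod_encode)
qed

lemma total_recursive_fst_prod_decode [recursive_intros]:
  "total_recursive k a \<Longrightarrow> total_recursive k (\<lambda>xs. fst (prod_decode (a xs)))"
  unfolding fst_prod_decode by (intro recursive_intros)

lemma total_recursive_snd_prod_decode [recursive_intros]:
  "total_recursive k a \<Longrightarrow> total_recursive k (\<lambda>xs. snd (prod_decode (a xs)))"
  unfolding snd_prod_decode by (intro recursive_intros)

section \<open>Kleene's recursion theorem\<close>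

text \<open>The fixed point is \<open>d v\<close>, where \<open>d x\<close> is an index of the
  function whose index is the value of \<open>\<phi> x x\<close>, nowhere defined if that diverges,
  and \<open>v\<close> is an index of \<open>g\<close> after \<open>d\<close>. Then
  \<open>d v\<close> and \<open>g (d v)\<close> index the same function, and the latter indexes
  \<open>\<psi> (d v)\<close>.\<close>

lemma recursion_theorem:
  assumes "acceptable_numbering \<phi>" "partial_computable2 \<psi>"
  shows "\<exists>e. \<phi> e = \<psi> e"
proof -
  have smn: "\<exists>f. computable f \<and> (\<forall>e. \<phi> (f e) = \<chi> e)" if "partial_computable2 \<chi>" for \<chi>
    using assms(1) that unfolding acceptable_numbering_def by blast
  obtain u where u: "\<And>x y. rec_eval u [x, y] = \<phi> x y"
    using assms(1) unfolding acceptable_numbering_def partial_computable2_def by blast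
  have "partial_computable2 (\<lambda>x y. case \<phi> x x of None \<Rightarrow> None | Some v \<Rightarrow> \<phi> v y)"
    unfolding partial_computable2_def
    by (intro exI[of _ "Comp u [Comp u [Proj 0, Proj 0], Proj 1]"])
      (auto simp: u split: option.split)
  from smn[OF this] obtain d where "computable d"
    and d: "\<And>x. \<phi> (d x) = (\<lambda>y. case \<phi> x x of None \<Rightarrow> None | Some v \<Rightarrow> \<phi> v y)"
    by blast
  from smn[OF assms(2)] obtain g where "computable g" and g: "\<And>e. \<phi> (g e) = \<psi> e"
    by blast
  \<comment> \<open>The first argument is a dummy, so any value of the translation function is an
    index \<open>v\<close>.\<close>
  have "computable2 (\<lambda>x y. g (d y))"
    by (intro computable2I total_recursive_comp[OF \<open>computable g\<close>]
        total_recursive_comp[OF \<open>computable d\<close>] recursive_intros) simp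
  from smn[OF this] obtain v where "\<And>y. \<phi> v y = Some (g (d y))"
    by metis
  then have "\<phi> (d v) = \<psi> (d v)"
    by (simp add: d g)
  then show ?thesis ..
qed

section \<open>The class of self-describing languages\<close>

text \<open>Demanding the largest even element, not the only one, leaves room for arbitrary finite
  subsets; the odd numbers stay free for diagonalisation.\<close>

definition self_describing :: "(nat \<Rightarrow> nat \<Rightarrow> nat option) \<Rightarrow> nat set set" where
  "self_describing \<phi> =
     {L. \<exists>e. 2 * e \<in> L \<and> (\<forall>e'. 2 * e' \<in> L \<longrightarrow> e' \<le> e) \<and> C_index \<phi> e \<and> C_set \<phi> e = L}"

lemma self_describing_REC:
  assumes "partial_computable2 \<phi>"
  shows "self_describing \<phi> \<subseteq> REC"
proof
  fix L assume "L \<in> self_describing \<phi>"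
  then obtain e where e: "C_index \<phi> e" "C_set \<phi> e = L"
    unfolding self_describing_def by blast
  obtain u where u: "\<And>x y. rec_eval u [x, y] = \<phi> x y"
    using assms unfolding partial_computable2_def by blast
  obtain c where c: "\<And>xs. length xs = 1 \<Longrightarrow> rec_eval c xs = Some e"
    using total_recursive_const[of 1 e] unfolding total_recursive_def by blast
  have "rec_eval (Comp u [c, Proj 0]) [x] = Some (if x \<in> L then 1 else 0)" for x
    using e u c unfolding C_index_def C_set_def by auto
  then show "L \<in> REC"
    unfolding REC_def computable_def partial_computable_def by blast
qed

text \<open>The witness is \<open>insert (2 * e) F\<close> for a fixed point \<open>e\<close>. Since
  \<open>2 * e\<close> must dominate the even elements of \<open>F\<close>, small fixed points are
  excluded by the case \<open>e \<le> m\<close>.\<close>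

lemma self_describing_extends_finite:
  assumes "acceptable_numbering \<phi>" "finite F"
  shows "\<exists>L\<in>self_describing \<phi>. F \<subseteq> L"
proof -
  obtain m where m: "\<And>x. x \<in> F \<Longrightarrow> x \<le> m"
    using Max_ge[OF assms(2)] by blast
  \<comment> \<open>The constant function \<open>c\<close> has no index up to \<open>m\<close>, so the fixed point exceeds \<open>m\<close>.\<close>
  obtain c where c: "c \<notin> (\<lambda>i. the (\<phi> i 0)) ` {..m}"
    using ex_new_if_finite[OF infinite_UNIV_nat finite_imageI[OF finite_atMost]] by blast
  have "computable2 (\<lambda>e x. if e \<le> m then c else of_bool (x = 2 * e \<or> x \<in> F))"
    by (intro computable2I recursive_intros assms(2)) simp_all
  from recursion_theorem[OF assms(1) this] obtain e
    where e: "\<phi> e = (\<lambda>x. Some (if e \<le> m then c else of_bool (x = 2 * e \<or> x \<in> F)))"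
    by blast
  have "m < e"
  proof (rule ccontr)
    assume "\<not> m < e"
    then have "c = the (\<phi> e 0)" "e \<in> {..m}"
      by (simp_all add: e)
    then show False
      using c by blast
  qed
  then have "C_index \<phi> e" "C_set \<phi> e = insert (2 * e) F"
    by (auto simp: C_index_def C_set_def e)
  \<comment> \<open>If \<open>2 * e'\<close> lies in \<open>F\<close>, then
    \<open>e' \<le> 2 * e' \<le> m < e\<close>.\<close>
  moreover have "e' \<le> e" if "2 * e' \<in> insert (2 * e) F" for e'
    using that m[of "2 * e'"] \<open>m < e\<close> by auto
  ultimately have "insert (2 * e) F \<in> self_describing \<phi>"
    unfolding self_describing_def by blast
  then show ?thesis by blast
qed

text \<open>The language built here has \<open>2 * e\<close> as its sole even element, and at
  \<open>Suc (2 * n)\<close> it disagrees with the set conjectured by \<open>h n\<close>. This is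
  decidable because \<open>h\<close> yields \<open>C\<close>-indices everywhere.\<close>

lemma self_describing_not_uniform:
  assumes "acceptable_numbering \<phi>" "partial_computable h"
    and h: "\<And>n. \<exists>e. h n = Some e \<and> C_index \<phi> e"
  shows "\<exists>L\<in>self_describing \<phi>. \<forall>n e. h n = Some e \<longrightarrow> C_set \<phi> e \<noteq> L"
proof -
  obtain u where u: "\<And>x y. rec_eval u [x, y] = \<phi> x y"
    using assms(1) unfolding acceptable_numbering_def partial_computable2_def by blast
  obtain r where r: "\<And>x. rec_eval r [x] = h x"
    using assms(2) unfolding partial_computable_def by blast
  \<comment> \<open>The characteristic function of the set conjectured on input \<open>x\<close>; by
    \<open>h\<close> both uses of \<open>the\<close> meet defined values.\<close>
  define t where "t x y = the (\<phi> (the (h x)) y)" for x y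
  have t: "\<exists>e. h x = Some e \<and> \<phi> e y = Some (t x y)" for x y
  proof -
    obtain e where "h x = Some e" "C_index \<phi> e"
      using h by blast
    moreover from this(2) have "\<phi> e y \<noteq> None"
      unfolding C_index_def by (metis option.distinct(1))
    ultimately show ?thesis
      by (auto simp: t_def)
  qed
  have "rec_eval (Comp u [Comp r [Proj 0], Proj 1]) [x, y] = Some (t x y)" for x y
    using t[of x y] by (auto simp: u r)
  then have "computable2 t"
    unfolding partial_computable2_def by blast
  \<comment> \<open>For odd \<open>y = Suc (2 * n)\<close>, \<open>y div 2\<close> recovers the
    number \<open>n\<close> of the hypothesis to be contradicted.\<close>
  then have "computable2 (\<lambda>e y. of_bool (if even y then y = 2 * e else t (y div 2) y = 0))"
    unfolding if_distrib[of of_bool]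
    by (intro computable2I recursive_intros total_recursive_comp2[OF \<open>computable2 t\<close>]) simp_all
  from recursion_theorem[OF assms(1) this] obtain e
    where e: "\<phi> e = (\<lambda>y. Some (of_bool (if even y then y = 2 * e else t (y div 2) y = 0)))"
    by blast
  have "C_index \<phi> e" "2 * e \<in> C_set \<phi> e" "\<And>e'. 2 * e' \<in> C_set \<phi> e \<Longrightarrow> e' \<le> e"
    by (auto simp: C_index_def C_set_def e of_bool_def split: if_splits)
  then have "C_set \<phi> e \<in> self_describing \<phi>"
    unfolding self_describing_def by blast
  moreover have "C_set \<phi> e' \<noteq> C_set \<phi> e" if "h n = Some e'" for n e'
  proof -
    have "Suc (2 * n) \<in> C_set \<phi> e \<longleftrightarrow> t n (Suc (2 * n)) = 0"
      by (simp add: C_set_def e)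
    moreover have "Suc (2 * n) \<in> C_set \<phi> e' \<longleftrightarrow> t n (Suc (2 * n)) = 1"
      using t[of n "Suc (2 * n)"] that by (auto simp: C_set_def)
    moreover have "t n (Suc (2 * n)) = 0 \<or> t n (Suc (2 * n)) = 1"
      using t[of n "Suc (2 * n)"] h[of n] unfolding C_index_def
      by (metis option.inject)
    ultimately show ?thesis by auto
  qed
  ultimately show ?thesis by blast
qed

section \<open>Failure of full-information learning with \<open>CInd\<close>\<close>

lemma text_extending_exists:
  assumes "{x. Some x \<in> set \<sigma>} \<subseteq> L"
  shows "\<exists>T. text_for T L \<and> initial_segment T (length \<sigma>) = \<sigma>"
proof (intro exI conjI)
  \<comment> \<open>After \<open>\<sigma>\<close>, the number \<open>x\<close> is shown at position
    \<open>x + length \<sigma>\<close> if it belongs to \<open>L\<close>; pauses elsewhere cover the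
    empty language too.\<close>
  define T where "T i = (if i < length \<sigma> then \<sigma> ! i
    else if i - length \<sigma> \<in> L then Some (i - length \<sigma>) else None)" for i
  show "initial_segment T (length \<sigma>) = \<sigma>"
    unfolding initial_segment_def by (rule nth_equalityI) (auto simp: T_def)
  have "x \<in> L" if "Some x = T i" for x i
    using that assms nth_mem[of i \<sigma>] by (auto simp: T_def split: if_splits)
  moreover have "T (x + length \<sigma>) = Some x" if "x \<in> L" for x
    using that by (simp add: T_def)
  ultimately show "text_for T L"
    unfolding text_for_def content_def by (auto simp: image_iff) metis
qed

text \<open>Every number is thus a genuine learner input, so a property of \<open>h\<close> on all
  finite sequences holds on all of its domain.\<close>

lemma list_encode_map_datum_encode_surj: "\<exists>\<sigma>. list_encode (map datum_encode \<sigma>) = n"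
proof -
  define decode where "decode c = (if c = 0 then None else Some (c - 1))" for c :: nat
  have "datum_encode (decode c) = c" for c
    by (simp add: decode_def)
  then have "list_encode (map datum_encode (map decode (list_decode n))) = n"
    by (simp add: comp_def)
  then show ?thesis ..
qed

lemma self_describing_not_CInd_Bc:
  assumes "acceptable_numbering \<phi>"
  shows "self_describing \<phi> \<notin> Txt_REC G (\<lambda>p T. CInd \<phi> p T \<and> Bc_C \<phi> p T)"
proof
  assume "self_describing \<phi> \<in> Txt_REC G (\<lambda>p T. CInd \<phi> p T \<and> Bc_C \<phi> p T)"
  then obtain h where "partial_computable h"
    and learns: "\<And>L T. \<lbrakk>L \<in> self_describing \<phi>; text_for T L\<rbrakk> \<Longrightarrow>
      CInd \<phi> (G h T) T \<and> Bc_C \<phi> (G h T) T"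
    unfolding Txt_REC_def Txt_learns_def by auto
  \<comment> \<open>\<open>CInd\<close> only constrains \<open>h\<close> on texts for the class, but
    every finite sequence begins such a text.\<close>
  have "\<exists>e. h n = Some e \<and> C_index \<phi> e" for n
  proof -
    obtain \<sigma> where \<sigma>: "list_encode (map datum_encode \<sigma>) = n"
      using list_encode_map_datum_encode_surj by blast
    have "finite {x. Some x \<in> set \<sigma>}"
      using finite_vimageI[of "set \<sigma>" Some] by (simp add: vimage_def)
    then obtain L where L: "L \<in> self_describing \<phi>" "{x. Some x \<in> set \<sigma>} \<subseteq> L"
      using self_describing_extends_finite[OF assms] by blast
    then obtain T where "text_for T L" "initial_segment T (length \<sigma>) = \<sigma>"
      using text_extending_exists by blast
    then show ?thesis
      using learns[of L T] L(1) \<sigma> unfolding CInd_def G_def by metis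
  qed
  with self_describing_not_uniform[OF assms \<open>partial_computable h\<close>]
  obtain L where L: "L \<in> self_describing \<phi>" "\<And>n e. h n = Some e \<Longrightarrow> C_set \<phi> e \<noteq> L"
    by blast
  obtain T where T: "text_for T L"
    using text_extending_exists[of "[]" L] by auto
  \<comment> \<open>A single correct conjecture suffices, since \<open>L\<close> is conjectured on
    no input at all.\<close>
  then obtain n e where "G h T n = Some e" "C_set \<phi> e = L"
    using learns[OF L(1) T] unfolding Bc_C_def text_for_def by blast
  then show False
    using L(2) unfolding G_def by blast
qed

section \<open>The iterative learner\<close>

text \<open>\<open>Some (2 * e)\<close> is encoded by \<open>2 * e + 1\<close>, whereas pauses and odd data have even codes.\<close>

definition keep_largest :: "nat \<Rightarrow> nat \<Rightarrow> nat" where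
  "keep_largest e d = (if \<not> even d \<and> e \<le> d div 2 then d div 2 else e)"

lemma keep_largest_datum_encode:
  "keep_largest e (datum_encode a) =
     (case a of None \<Rightarrow> e | Some x \<Rightarrow> if even x then max e (x div 2) else e)"
  by (auto simp: keep_largest_def split: option.split)

text \<open>Input \<open>0\<close> codes the empty list; a pair is coded as \<open>list_encode
  [e, d] = Suc (prod_encode (e, Suc (prod_encode (d, 0))))\<close>, whence the two predecessors. The
  initial hypothesis \<open>0\<close> is below every index.\<close>

definition max_learner :: "nat \<Rightarrow> nat" where
  "max_learner z = (if z = 0 then 0 else
     keep_largest (fst (prod_decode (z - 1)))
       (fst (prod_decode (snd (prod_decode (z - 1)) - 1))))"

lemma max_learner_Nil: "max_learner (list_encode []) = 0"
  by (simp add: max_learner_def)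

lemma max_learner_pair: "max_learner (list_encode [e, d]) = keep_largest e d"
  by (simp add: max_learner_def)

lemma computable_max_learner: "computable max_learner"
  unfolding max_learner_def keep_largest_def
  by (intro computableI recursive_intros) simp_all

text \<open>The hypothesis is itself the running maximum, so an iterative learner needs no further
  memory. It is nondecreasing, bounded by \<open>e\<close>, and reaches \<open>e\<close> once
  \<open>2 * e\<close> has appeared.\<close>

lemma max_learner_learns:
  assumes "L \<in> self_describing \<phi>" "text_for T L"
  shows "Ex_C \<phi> (It (\<lambda>z. Some (max_learner z)) T) T"
proof -
  obtain e where e: "2 * e \<in> L" "\<And>e'. 2 * e' \<in> L \<Longrightarrow> e' \<le> e" "C_index \<phi> e" "C_set \<phi> e = L"
    using assms(1) unfolding self_describing_def by blast
  have T: "x \<in> L \<longleftrightarrow> (\<exists>i. T i = Some x)" for x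
    using assms(2) unfolding text_for_def content_def by (auto simp: image_iff) metis
  define m where "m = rec_nat 0 (\<lambda>i r. keep_largest r (datum_encode (T i)))"
  have m_0: "m 0 = 0" and m_Suc: "m (Suc i) = keep_largest (m i) (datum_encode (T i))" for i
    by (simp_all add: m_def)
  have It: "It (\<lambda>z. Some (max_learner z)) T i = Some (m i)" for i
    by (induction i) (simp_all add: m_0 m_Suc max_learner_Nil max_learner_pair
        del: list_encode.simps)
  have T_le: "x div 2 \<le> e" if "T i = Some x" "even x" for x i
    using that T e(2)[of "x div 2"] by auto
  have "m i \<le> e" for i
  proof (induction i)
    case (Suc i)
    then show ?case
      by (auto simp: m_Suc keep_largest_datum_encode T_le split: option.split)
  qed (simp add: m_0)
  moreover obtain j where j: "T j = Some (2 * e)"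
    using e(1) T by blast
  \<comment> \<open>Hypothesis \<open>i\<close> has processed only the data before position
    \<open>i\<close>, so \<open>T j\<close> takes effect from \<open>Suc j\<close> on.\<close>
  have "e \<le> m i" if "Suc j \<le> i" for i
    using that
  proof (induction i rule: dec_induct)
    case base
    show ?case
      by (simp add: m_Suc keep_largest_def j)
  next
    case (step i)
    have "m i \<le> m (Suc i)"
      by (auto simp: m_Suc keep_largest_datum_encode split: option.split)
    with step.IH show ?case by simp
  qed
  ultimately have "m i = e" if "Suc j \<le> i" for i
    using that by (simp add: antisym)
  then show ?thesis
    using e(3,4) assms(2) unfolding Ex_C_def text_for_def
    by (intro exI[of _ "Suc j"]) (simp add: It del: It.simps)
qed

theorem theorem8:
  fixes \<phi> :: "nat \<Rightarrow> nat \<Rightarrow> nat option"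
  assumes "acceptable_numbering \<phi>"
  shows "Txt_REC It (Ex_C \<phi>) - Txt_REC G (\<lambda>p T. CInd \<phi> p T \<and> Bc_C \<phi> p T) \<noteq> {}"
proof -
  have "self_describing \<phi> \<subseteq> REC"
    using assms unfolding acceptable_numbering_def by (intro self_describing_REC) simp
  moreover have "partial_computable (\<lambda>z. Some (max_learner z))"
    using computable_max_learner unfolding computable_def .
  ultimately have "self_describing \<phi> \<in> Txt_REC It (Ex_C \<phi>)"
    unfolding Txt_REC_def Txt_learns_def using max_learner_learns by blast
  with self_describing_not_CInd_Bc[OF assms] show ?thesis by blast
qed

end
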